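(* Let $k$ and $s\ge -2$ be integers, let $\alpha$ be a real number, and let $G$ be a balanced bipartite graph with $|V(G)|=2n\ge 6k+8$ and $\delta(G)\ge k\ge\max\{|s|,1\}$. If $\Theta(G,\alpha)>\Theta_0(s)$ and $0\le\alpha\le1$, then either $\mathscr{B}_{n+s}(G)=K_{n,n}$ or $G\subseteq F_{n,k,s}$.
   Context: Graphs are finite, simple and undirected; equality and the subgraph relation $\subseteq$ between graphs are up to isomorphism. A bipartite graph $G=[U,V]$ is balanced if $|U|=|V|$. $\delta(G)$ is the minimum degree. For real $\alpha\ge0$, $\Theta(G,\alpha)$ is the largest eigenvalue of $A(G)+\alpha D(G)$, where $A(G)$ is the adjacency matrix and $D(G)$ the diagonal degree matrix. Define $$\varepsilon_0(s)=n(n+s-k-2)+(k+1)(k+2-s),\qquad \Theta_0(s)=\alpha\left(\frac{\varepsilon_0(s)}{n}+n\right)+(1-\alpha)\sqrt{\varepsilon_0(s)}.$$ For an integer $\ell>0$ and a bipartite graph $G=[U,V]$, the bipartite closure $\mathscr{B}_\ell(G)$ is the bipartite graph obtained from $G$ by recursively joining pairs of nonadjacent vertices $u\in U$, $v\in V$ whose degree sum (in the current graph) is at least $\ell$ until no such pair remains nonadjacent. For integers $n>k\ge 0$, $a\ge k+1$, $b\ge1$, let $(X,Y)$ be the bipartition of $K_{n,a+b}$ with $|X|=n$, $|Y|=a+b$, let $X_1\subset X$ with $|X_1|=n-k$ and $Y_1\subset Y$ with $|Y_1|=b$. Then $Z_{a,b}$ (depending also on $n,k$) is the graph obtained from $K_{n,a+b}$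 by deleting all edges between $X_1$ and $Y_1$. Define $F_{n,k,s}=Z_{n+s-k-1,\,k+1-s}$. *)

theory Defs
  imports
    "Graph_Theory.Kuratowski"
    "Graph_Theory.Digraph_Isomorphism"
    "Jordan_Normal_Form.Spectral_Radius"
begin

text \<open>
  As in \<open>Graph_Theory\<close>, a finite simple undirected graph is a finite loop-free symmetric
  digraph without parallel arcs, i.e. \<open>pair_graph G\<close>: an edge \<open>uv\<close> is represented by the
  two arcs \<open>(u, v)\<close> and \<open>(v, u)\<close>.  Consequently the degree of a vertex is its out-degree
  (equivalently, its in-degree).
\<close>

definition vdegree :: "'a pair_pre_digraph \<Rightarrow> 'a \<Rightarrow> nat" where
  "vdegree G v = out_degree (with_proj G) v"

definition min_degree :: "'a pair_pre_digraph \<Rightarrow> nat" where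
  "min_degree G = Min (vdegree G ` pverts G)"

text \<open>\<open>G \<subseteq> H\<close> up to isomorphism; bipartitions play no role here.\<close>

definition subgraph_upto_iso :: "'a pair_pre_digraph \<Rightarrow> 'b pair_pre_digraph \<Rightarrow> bool" where
  "subgraph_upto_iso G H \<longleftrightarrow>
     (\<exists>H'. subgraph H' (with_proj H) \<and> digraph_iso (with_proj G) H')"

definition bipartition :: "'a pair_pre_digraph \<Rightarrow> 'a set \<Rightarrow> 'a set \<Rightarrow> bool" where
  "bipartition G U V \<longleftrightarrow>
     pverts G = U \<union> V \<and> U \<inter> V = {} \<and> parcs G \<subseteq> U \<times> V \<union> V \<times> U"


subsection \<open>The largest eigenvalue of \<open>A(G) + \<alpha> D(G)\<close>\<close>

text \<open>
  Matrices are indexed by \<open>0, \<dots>, |V(G)| - 1\<close>, so the vertices are listed in some arbitrary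
  order; another order conjugates the matrices by a permutation matrix and does not change
  the spectrum.
\<close>

definition vertex_list :: "'a pair_pre_digraph \<Rightarrow> 'a list" where
  "vertex_list G = (SOME vs. distinct vs \<and> set vs = pverts G)"

definition adjacency_mat :: "'a pair_pre_digraph \<Rightarrow> real mat" where
  "adjacency_mat G = Matrix.mat (card (pverts G)) (card (pverts G))
     (\<lambda>(i, j). if (vertex_list G ! i, vertex_list G ! j) \<in> parcs G then 1 else 0)"

definition degree_mat :: "'a pair_pre_digraph \<Rightarrow> real mat" where
  "degree_mat G = mat_diag (card (pverts G)) (\<lambda>i. real (vdegree G (vertex_list G ! i)))"

text \<open>The matrix is real symmetric, so all its eigenvalues lie in the real spectrum used here.\<close>

definition Theta :: "'a pair_pre_digraph \<Rightarrow> real \<Rightarrow> real" where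
  "Theta G \<alpha> = Max (spectrum (adjacency_mat G + \<alpha> \<cdot>\<^sub>m degree_mat G))"

definition eps0 :: "nat \<Rightarrow> int \<Rightarrow> int \<Rightarrow> int" where
  "eps0 n k s = int n * (int n + s - k - 2) + (k + 1) * (k + 2 - s)"

definition Theta0 :: "real \<Rightarrow> nat \<Rightarrow> int \<Rightarrow> int \<Rightarrow> real" where
  "Theta0 \<alpha> n k s =
     \<alpha> * (real_of_int (eps0 n k s) / real n + real n) + (1 - \<alpha>) * sqrt (real_of_int (eps0 n k s))"


subsection \<open>Bipartite closure\<close>

definition join_verts :: "'a pair_pre_digraph \<Rightarrow> 'a \<Rightarrow> 'a \<Rightarrow> 'a pair_pre_digraph" where
  "join_verts G u v = G\<lparr>parcs := parcs G \<union> {(u, v), (v, u)}\<rparr>"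

definition joinable ::
  "int \<Rightarrow> 'a set \<Rightarrow> 'a set \<Rightarrow> 'a pair_pre_digraph \<Rightarrow> 'a \<Rightarrow> 'a \<Rightarrow> bool" where
  "joinable l U V G u v \<longleftrightarrow>
     u \<in> U \<and> v \<in> V \<and> (u, v) \<notin> parcs G \<and> l \<le> int (vdegree G u + vdegree G v)"

definition closure_step ::
  "int \<Rightarrow> 'a set \<Rightarrow> 'a set \<Rightarrow> 'a pair_pre_digraph \<Rightarrow> 'a pair_pre_digraph \<Rightarrow> bool" where
  "closure_step l U V G H \<longleftrightarrow> (\<exists>u v. joinable l U V G u v \<and> H = join_verts G u v)"

definition is_bip_closure ::
  "int \<Rightarrow> 'a set \<Rightarrow> 'a set \<Rightarrow> 'a pair_pre_digraph \<Rightarrow> 'a pair_pre_digraph \<Rightarrow> bool" where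
  "is_bip_closure l U V G H \<longleftrightarrow>
     (closure_step l U V)\<^sup>*\<^sup>* G H \<and> (\<nexists>u v. joinable l U V H u v)"

text \<open>The order of the joins is irrelevant: see \<open>is_bip_closure_unique\<close> below.\<close>

definition bipartite_closure ::
  "int \<Rightarrow> 'a set \<Rightarrow> 'a set \<Rightarrow> 'a pair_pre_digraph \<Rightarrow> 'a pair_pre_digraph" where
  "bipartite_closure l U V G = (THE H. is_bip_closure l U V G H)"

lemma vdegree_eq: "vdegree G v = card {e \<in> parcs G. fst e = v}"
  by (simp add: vdegree_def out_degree_def out_arcs_def with_proj_def)

lemma vdegree_mono:
  assumes "finite (parcs H)" "parcs G \<subseteq> parcs H"
  shows "vdegree G v \<le> vdegree H v"
  unfolding vdegree_eq using assms by (intro card_mono) auto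

lemma closure_steps_properties:
  assumes "(closure_step l U V)\<^sup>*\<^sup>* G H" "finite (parcs G)" "sym (parcs G)"
  shows "pverts H = pverts G \<and> parcs G \<subseteq> parcs H \<and> finite (parcs H) \<and> sym (parcs H)"
  using assms
  by (induction rule: rtranclp_induct)
     (auto simp: closure_step_def join_verts_def sym_def)

lemma closure_steps_below:
  assumes "(closure_step l U V)\<^sup>*\<^sup>* G H" "is_bip_closure l U V G K"
    and fin: "finite (parcs G)" and sym: "sym (parcs G)"
  shows "parcs H \<subseteq> parcs K"
  using assms(1)
proof (induction rule: rtranclp_induct)
  case base
  show ?case
    using closure_steps_properties[OF _ fin sym] assms(2) by (meson is_bip_closure_def)
next
  case (step H H')
  have K: "finite (parcs K)" "sym (parcs K)"
    using closure_steps_properties[OF _ fin sym] assms(2) by (meson is_bip_closure_def)+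
  obtain u v where uv: "joinable l U V H u v" and H': "H' = join_verts H u v"
    using step.hyps(2) by (auto simp: closure_step_def)
  have "(u, v) \<in> parcs K"
  proof (rule ccontr)
    assume "(u, v) \<notin> parcs K"
    moreover have "vdegree H u \<le> vdegree K u" "vdegree H v \<le> vdegree K v"
      using vdegree_mono[OF K(1) step.IH] by auto
    ultimately have "joinable l U V K u v"
      using uv by (auto simp: joinable_def)
    then show False using assms(2) by (auto simp: is_bip_closure_def)
  qed
  then show ?case
    using step.IH K(2) by (auto simp: H' join_verts_def sym_def)
qed

lemma is_bip_closure_exists:
  assumes "finite U" "finite V"
  shows "\<exists>H. is_bip_closure l U V G H"
proof (induction "card (U \<times> V - parcs G)" arbitrary: G rule: less_induct)
  case less
  show ?case
  proof (cases "\<exists>u v. joinable l U V G u v")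
    case False
    then show ?thesis by (auto simp: is_bip_closure_def)
  next
    case True
    then obtain u v where uv: "joinable l U V G u v" by blast
    have "U \<times> V - parcs (join_verts G u v) \<subset> U \<times> V - parcs G"
      using uv by (auto simp: joinable_def join_verts_def)
    then have "card (U \<times> V - parcs (join_verts G u v)) < card (U \<times> V - parcs G)"
      using assms by (intro psubset_card_mono) auto
    from less[OF this] obtain H where "is_bip_closure l U V (join_verts G u v) H" by blast
    then have "is_bip_closure l U V G H"
      using uv unfolding is_bip_closure_def
      by (metis closure_step_def converse_rtranclp_into_rtranclp)
    then show ?thesis ..
  qed
qed

lemma is_bip_closure_unique:
  assumes "pair_graph G" "bipartition G U V"
  shows "\<exists>!H. is_bip_closure l U V G H"
proof -
  interpret pair_graph G by fact
  have UV: "finite U" "finite V"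
    using assms(2) pair_finite_verts by (auto simp: bipartition_def)
  have sym: "sym (parcs G)"
    using pair_sym_arcs by (simp add: symmetric_def)
  show ?thesis
  proof (rule ex_ex1I)
    show "\<exists>H. is_bip_closure l U V G H" by (rule is_bip_closure_exists[OF UV])
  next
    fix H K assume HK: "is_bip_closure l U V G H" "is_bip_closure l U V G K"
    then have steps: "(closure_step l U V)\<^sup>*\<^sup>* G H" "(closure_step l U V)\<^sup>*\<^sup>* G K"
      by (auto simp: is_bip_closure_def)
    have "parcs H = parcs K"
      using closure_steps_below[OF steps(1) HK(2) pair_finite_arcs sym]
        closure_steps_below[OF steps(2) HK(1) pair_finite_arcs sym] by blast
    moreover have "pverts H = pverts K"
      using closure_steps_properties[OF steps(1) pair_finite_arcs sym]
        closure_steps_properties[OF steps(2) pair_finite_arcs sym] by simp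
    ultimately show "H = K" by simp
  qed
qed

lemma bipartite_closure:
  assumes "pair_graph G" "bipartition G U V"
  shows "is_bip_closure l U V G (bipartite_closure l U V G)"
  unfolding bipartite_closure_def using theI'[OF is_bip_closure_unique[OF assms]] .


subsection \<open>The exceptional graphs\<close>

text \<open>
  The parts of \<open>K\<^bsub>n,a+b\<^esub>\<close> are \<open>X = {0, \<dots>, n - 1}\<close> (tagged \<open>Inl\<close>) and
  \<open>Y = {0, \<dots>, a + b - 1}\<close> (tagged \<open>Inr\<close>); \<open>X\<^sub>1\<close> and \<open>Y\<^sub>1\<close> are their initial segments
  of sizes \<open>n - k\<close> and \<open>b\<close>.
\<close>

definition Z_graph :: "nat \<Rightarrow> nat \<Rightarrow> nat \<Rightarrow> nat \<Rightarrow> (nat + nat) pair_pre_digraph" where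
  "Z_graph n k a b =
     (let X = Inl ` {..<n}; Y = Inr ` {..<a + b};
          X1 = Inl ` {..<n - k}; Y1 = Inr ` {..<b};
          E = X \<times> Y - X1 \<times> Y1
      in \<lparr>pverts = X \<union> Y, parcs = E \<union> E\<inverse>\<rparr>)"

text \<open>
  Meaningful for \<open>0 \<le> k < n\<close>, \<open>s \<le> k\<close> and \<open>2 k + 2 \<le> n + s\<close>; then no argument of \<open>nat\<close>
  is negative.
\<close>

definition F_graph :: "nat \<Rightarrow> int \<Rightarrow> int \<Rightarrow> (nat + nat) pair_pre_digraph" where
  "F_graph n k s = Z_graph n (nat k) (nat (int n + s - k - 1)) (nat (k + 1 - s))"

end

theory Submission
  imports Defs "HOL-Analysis.Convex"
begin

text \<open>
  The spectral hypothesis only serves to show that \<open>G\<close> has more than \<^term>\<open>eps0 n k s\<close>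
  edges.  Indeed, if \<open>e\<close> is the number of edges, the quadratic form of \<open>A\<close> is at most
  \<open>sqrt e |x|\<^sup>2\<close> by the Cauchy--Schwarz inequality, and that of \<open>A + D\<close> is at most
  \<open>(e / n + n) |x|\<^sup>2\<close> by weighting the products over the edges with ratios of degrees.
  As \<open>A + \<alpha> D = \<alpha> (A + D) + (1 - \<alpha>) A\<close>, an eigenvector for the largest eigenvalue shows that
  this eigenvalue is at most \<open>\<alpha> (e / n + n) + (1 - \<alpha>) sqrt e\<close> (lemma \<open>Theta_le\<close>).  This is
  monotone in \<open>e\<close> and equals \<^term>\<open>Theta0 \<alpha> n k s\<close> for \<open>e = eps0 n k s\<close>.

  The rest is counting.  Let \<open>H\<close> be the closure of \<open>G\<close>.  Having more than \<^term>\<open>eps0 n k s\<close>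
  edges means that fewer than \<open>(k + 2 - s) (n - k - 1)\<close> edges are missing from the complete
  bipartite graph.  If \<open>H\<close> is not complete, take a nonadjacent pair \<open>u, v\<close> with the largest
  degree sum; this sum is below \<open>n + s\<close>.  If \<open>h\<close> is the smaller degree of the two, then at
  least \<open>h + 1 - s\<close> vertices in one part have degree at most \<open>h\<close>, which costs at least
  \<open>(h + 1 - s) (n - h)\<close> edges.  Since \<open>k \<le> h \<le> (n + s - 1) / 2\<close>, the number of missing
  edges only allows \<open>h = k\<close>, with exactly \<open>k + 1 - s\<close> such vertices, all of degree \<open>k\<close>; a
  second count shows that they have the same \<open>k\<close> neighbours
  (lemma \<open>closed_bipartite_low_degree_set\<close>).  So \<open>H\<close>, and with it \<open>G\<close>, has no edge between
  \<open>k + 1 - s\<close> vertices of one part and \<open>n - k\<close> vertices of the other, as in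
  \<^term>\<open>F_graph n k s\<close>.
\<close>

section \<open>Dense bipartite relations without joinable pairs\<close>

text \<open>
  Double counting.  It is applied to the relation \<open>M\<close> of nonadjacent pairs across the
  bipartition, where it turns upper bounds for degrees into lower bounds for the number of
  missing edges.
\<close>

lemma card_incidences_ge:
  fixes M :: "('a \<times> 'b) set" and c :: int
  assumes "finite M" "finite Z" "\<And>z. z \<in> Z \<Longrightarrow> c \<le> int (card (M `` {z}))"
  shows "int (card Z) * c \<le> int (card {p \<in> M. fst p \<in> Z})"
proof -
  have eq: "{p \<in> M. fst p \<in> Z} = (SIGMA z:Z. M `` {z})" by auto
  have fin: "finite (M `` {z})" for z
    using assms(1) by (rule finite_Image)
  have "int (card {p \<in> M. fst p \<in> Z}) = (\<Sum>z\<in>Z. int (card (M `` {z})))"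
    unfolding eq by (subst card_SigmaI) (use assms(2) fin in auto)
  also have "\<dots> \<ge> (\<Sum>z\<in>Z. c)"
    using assms(3) by (rule sum_mono)
  finally show ?thesis by simp
qed

text \<open>
  The heart of the combinatorial part.  The inequality \<open>dense\<close> says that more than
  \<^term>\<open>eps0 n k s\<close> edges are present.  Write \<open>h\<close> for the degree of \<open>u\<close> and let \<open>Z\<close> be the
  set of nonneighbours of \<open>v\<close>.  As \<open>(u, v)\<close> maximises the degree sum over all nonadjacent
  pairs, every vertex of \<open>Z\<close> has degree at most \<open>h\<close>, and \<open>closed\<close> gives
  \<open>card Z \<ge> h + 1 - s\<close>; hence at least \<open>(h + 1 - s) (n - h)\<close> edges are missing.  This is too
  many if \<open>h > k\<close>, and for \<open>h = k\<close> it leaves room for exactly \<open>k + 1 - s\<close> vertices in \<open>Z\<close>.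

  These vertices must all have the neighbours of \<open>u\<close>.  Otherwise some \<open>w\<close> is adjacent
  to a vertex of \<open>Z\<close> but not to \<open>u\<close>.  Then \<open>closed\<close> forces \<open>w\<close> to have many
  nonneighbours, at least one of them outside \<open>Z\<close>, and those outside \<open>Z\<close> have small degree
  in turn: they account for \<open>n - k\<close> further missing edges, again too many.
\<close>

lemma closed_bipartite_low_degree_set:
  fixes E :: "('a \<times> 'b) set" and n :: nat and k s :: int
  assumes fin: "finite U" "finite V" and card: "card U = n" "card V = n"
    and E: "E \<subseteq> U \<times> V" and "s \<le> k"
    and degU: "\<And>u. u \<in> U \<Longrightarrow> k \<le> int (card (E `` {u}))"
    and degV: "\<And>v. v \<in> V \<Longrightarrow> k \<le> int (card (E\<inverse> `` {v}))"
    and closed: "\<And>u v. (u, v) \<in> U \<times> V - E \<Longrightarrow>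
        int (card (E `` {u}) + card (E\<inverse> `` {v})) < int n + s"
    and dense: "int (card (U \<times> V - E)) < (int n - k - 1) * (k + 2 - s)"
    and uv: "(u, v) \<in> U \<times> V - E"
    and max: "\<And>u' v'. (u', v') \<in> U \<times> V - E \<Longrightarrow>
        card (E `` {u'}) + card (E\<inverse> `` {v'}) \<le> card (E `` {u}) + card (E\<inverse> `` {v})"
    and le: "card (E `` {u}) \<le> card (E\<inverse> `` {v})"
  shows "\<exists>Z N. Z \<subseteq> U \<and> N \<subseteq> V \<and> int (card Z) = k + 1 - s \<and> int (card N) = k \<and> E `` Z \<subseteq> N"
proof -
  define M where "M = U \<times> V - E"
  define dU where "dU x = int (card (E `` {x}))" for x
  define dV where "dV y = int (card (E\<inverse> `` {y}))" for y
  define h where "h = dU u"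
  define Z where "Z = U - E\<inverse> `` {v}"
  have finM: "finite M" and finZ: "finite Z"
    using fin by (auto simp: M_def Z_def)
  have cardM: "int (card M) < (int n - k - 1) * (k + 2 - s)"
    using dense by (simp add: M_def)
  have missU: "int (card (M `` {x})) = int n - dU x" if "x \<in> U" for x
  proof -
    have "M `` {x} = V - E `` {x}" and "E `` {x} \<subseteq> V" using that E by (auto simp: M_def)
    then show ?thesis
      using fin card by (metis card_Diff_subset card_mono dU_def finite_subset of_nat_diff)
  qed
  have missV: "int (card (U - E\<inverse> `` {y})) = int n - dV y" for y
  proof -
    have "E\<inverse> `` {y} \<subseteq> U" using E by auto
    then show ?thesis
      using fin card by (metis card_Diff_subset card_mono dV_def finite_subset of_nat_diff)
  qed
  have closed': "dU x + dV y \<le> int n + s - 1" if "(x, y) \<in> M" for x y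
    using closed[of x y] that by (simp add: M_def dU_def dV_def)
  have uvM: "(u, v) \<in> M" "u \<in> U" "v \<in> V" using uv by (auto simp: M_def)
  have hk: "k \<le> h" using degU uvM by (simp add: h_def dU_def)
  have hv: "h \<le> dV v" using le by (simp add: h_def dU_def dV_def)
  have hn: "h + dV v \<le> int n + s - 1" using closed' uvM by (simp add: h_def)
  \<comment> \<open>Maximality of the degree sum: nonneighbours of \<open>v\<close> have at most the degree of \<open>u\<close>.\<close>
  have Zdeg: "dU z \<le> h" if "z \<in> Z" for z
    using max[of z v] that uvM by (auto simp: Z_def h_def dU_def)
  have Zcard: "int (card Z) \<ge> h + 1 - s"
    using missV[of v] hn by (simp add: Z_def)
  have missing: "int (card Z) * (int n - h) \<le> int (card {p \<in> M. fst p \<in> Z})"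
    using Zdeg missU by (intro card_incidences_ge finM finZ) (auto simp: Z_def)
  have sub: "int (card {p \<in> M. fst p \<in> Z}) \<le> int (card M)"
    using finM by (intro of_nat_mono card_mono) auto
  have n_h: "0 \<le> int n - h" using \<open>s \<le> k\<close> hk hn hv by linarith
  have "h = k"
  proof (rule ccontr)
    assume "h \<noteq> k"
    then have "h \<ge> k + 1" using hk by simp
    \<comment> \<open>The parabola \<open>(h + 1 - s) (n - h)\<close> increases up to \<open>h = (n + s - 1) / 2\<close>.\<close>
    then have "0 \<le> (h - (k + 1)) * (int n + s - 1 - h - (k + 1))"
      using hn hv by (intro mult_nonneg_nonneg) linarith+
    also have "\<dots> = (h + 1 - s) * (int n - h) - (int n - k - 1) * (k + 2 - s)"
      by (simp add: algebra_simps)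
    finally have "(int n - k - 1) * (k + 2 - s) \<le> (h + 1 - s) * (int n - h)" by simp
    also have "\<dots> \<le> int (card Z) * (int n - h)"
      using Zcard n_h by (rule mult_right_mono)
    finally show False using missing sub cardM by linarith
  qed
  \<comment> \<open>A weakened form of \<open>cardM\<close>: there are fewer than \<open>(k + 2 - s) (n - k)\<close> missing edges.\<close>
  have few_missing: "c * (int n - k) < (k + 2 - s) * (int n - k)" if "c * (int n - k) \<le> int (card M)" for c
  proof -
    have "(int n - k - 1) * (k + 2 - s) \<le> (k + 2 - s) * (int n - k)"
      using \<open>s \<le> k\<close> by (simp add: algebra_simps)
    then show ?thesis using that cardM by linarith
  qed
  have nk: "0 \<le> int n - k" using n_h \<open>h = k\<close> by simp
  have "int (card Z) < k + 2 - s"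
    using few_missing[of "int (card Z)"] missing sub nk \<open>h = k\<close> by (meson mult_right_less_imp_less order_trans)
  then have Zk: "int (card Z) = k + 1 - s" using Zcard \<open>h = k\<close> by simp
  have "E `` Z \<subseteq> E `` {u}"
  proof
    fix w assume "w \<in> E `` Z"
    then obtain z where z: "z \<in> Z" "(z, w) \<in> E" by auto
    then have w: "w \<in> V" using E by auto
    show "w \<in> E `` {u}"
    proof (rule ccontr)
      assume "w \<notin> E `` {u}"
      then have uw: "(u, w) \<in> M" using w uvM by (auto simp: M_def)
      define P where "P = U - E\<inverse> `` {w} - Z"
      have finP: "finite P" using fin by (auto simp: P_def)
      have mw: "dV w \<le> int n + s - 1 - k" using closed'[OF uw] \<open>h = k\<close> by (simp add: h_def)
      have "card (U - E\<inverse> `` {w}) \<le> card (P \<union> (Z - {z}))"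
        using z finP finZ by (intro card_mono) (auto simp: P_def)
      also have "\<dots> \<le> card P + card (Z - {z})" by (rule card_Un_le)
      finally have "int (card (U - E\<inverse> `` {w})) \<le> int (card P) + int (card (Z - {z}))" by simp
      moreover have "int (card (Z - {z})) = k - s"
        using card.remove[OF finZ z(1)] Zk by simp
      ultimately have P: "int n - dV w - (k - s) \<le> int (card P)"
        using missV[of w] by linarith
      have missP: "int (card P) * (dV w + 1 - s) \<le> int (card {p \<in> M. fst p \<in> P})"
      proof (intro card_incidences_ge finM finP)
        fix x assume "x \<in> P"
        then have "x \<in> U" "(x, w) \<in> M" using w by (auto simp: P_def M_def)
        then show "dV w + 1 - s \<le> int (card (M `` {x}))"
          using closed'[of x w] missU[of x] by simp
      qed
      have dw: "dV w \<ge> k" using degV[OF w] by (simp add: dV_def)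
      \<comment> \<open>This is \<open>a + b - 1 \<le> a b\<close> for the lower bounds \<open>a = n - dV w - (k - s)\<close> on \<open>card P\<close> and
          \<open>b = dV w + 1 - s\<close> on the missing edges at a vertex of \<open>P\<close>; both are at least 1.\<close>
      have "0 \<le> (int n - dV w - (k - s) - 1) * (dV w + 1 - s - 1)"
        using mw dw \<open>s \<le> k\<close> by (intro mult_nonneg_nonneg) linarith+
      then have "int n - k \<le> (int n - dV w - (k - s)) * (dV w + 1 - s)"
        by (simp add: algebra_simps)
      also have "\<dots> \<le> int (card P) * (dV w + 1 - s)"
        using P dw \<open>s \<le> k\<close> by (intro mult_right_mono) auto
      finally have Pge: "int n - k \<le> int (card {p \<in> M. fst p \<in> P})" using missP by linarith
      have "card ({p \<in> M. fst p \<in> Z} \<union> {p \<in> M. fst p \<in> P})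
          = card {p \<in> M. fst p \<in> Z} + card {p \<in> M. fst p \<in> P}"
        using finM by (intro card_Un_disjoint) (auto simp: P_def)
      moreover have "card ({p \<in> M. fst p \<in> Z} \<union> {p \<in> M. fst p \<in> P}) \<le> card M"
        using finM by (intro card_mono) auto
      ultimately have "(k + 1 - s) * (int n - k) + (int n - k) \<le> int (card M)"
        using missing Zk \<open>h = k\<close> Pge by simp
      then have "(k + 2 - s) * (int n - k) \<le> int (card M)" by (simp add: algebra_simps)
      from few_missing[OF this] show False by simp
    qed
  qed
  moreover have "E `` {u} \<subseteq> V" "Z \<subseteq> U" "int (card (E `` {u})) = k"
    using E \<open>h = k\<close> by (auto simp: Z_def h_def dU_def)
  ultimately show ?thesis using Zk by blast
qed

section \<open>Embedding into the exceptional graphs\<close>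

lemma exists_enumeration_initial_segment:
  assumes "finite A" "B \<subseteq> A" "card A = m" "card B = l"
  obtains g where "bij_betw g A {..<m}" "g ` B = {..<l}"
proof -
  have fin: "finite B" "finite (A - B)" using assms finite_subset by auto
  have le: "l \<le> m" using assms card_mono by blast
  obtain g1 where g1: "bij_betw g1 B {..<l}"
    using fin(1) assms(4) bij_betw_iff_card[of B "{..<l}"] by auto
  have "card (A - B) = card {l..<m}" using assms fin by (simp add: card_Diff_subset)
  then obtain g2 where g2: "bij_betw g2 (A - B) {l..<m}"
    using fin(2) bij_betw_iff_card[of "A - B" "{l..<m}"] by auto
  define g where "g x = (if x \<in> B then g1 x else g2 x)" for x
  have b1: "bij_betw g B {..<l}"
    using g1 by (rule bij_betw_cong[THEN iffD1, rotated]) (simp add: g_def)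
  have b2: "bij_betw g (A - B) {l..<m}"
    using g2 by (rule bij_betw_cong[THEN iffD1, rotated]) (simp add: g_def)
  have "bij_betw g (B \<union> (A - B)) ({..<l} \<union> {l..<m})"
    by (rule bij_betw_combine[OF b1 b2]) auto
  moreover have "B \<union> (A - B) = A" "{..<l} \<union> {l..<m} = {..<m}" using assms(2) le by auto
  ultimately show ?thesis using that b1 by (metis bij_betw_imp_surj_on)
qed

text \<open>
  For digraphs without parallel arcs an injective homomorphism on the vertices already
  determines the isomorphism onto a subgraph, as arcs are pairs of vertices.
\<close>

lemma subgraph_upto_isoI:
  fixes G :: "'a pair_pre_digraph" and F :: "'b pair_pre_digraph"
  assumes "pair_wf_digraph G" "pair_wf_digraph F"
    and inj: "inj_on f (pverts G)" and verts: "f ` pverts G \<subseteq> pverts F"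
    and arcs: "\<And>x y. (x, y) \<in> parcs G \<Longrightarrow> (f x, f y) \<in> parcs F"
  shows "subgraph_upto_iso G F"
proof -
  interpret G: pair_wf_digraph G by fact
  interpret F: pair_wf_digraph F by fact
  define hom where "hom = \<lparr>iso_verts = f, iso_arcs = map_prod f f, iso_head = snd, iso_tail = fst\<rparr>"
  have inj2: "inj_on (map_prod f f) (parcs G)"
    using map_prod_inj_on[OF inj inj] by (rule inj_on_subset) (auto dest: G.in_arcsD1 G.in_arcsD2)
  have iso: "pre_digraph.digraph_isomorphism (with_proj G) hom"
    unfolding pre_digraph.digraph_isomorphism_def using inj inj2 G.wf_digraph
    by (simp add: hom_def)
  have "wf_digraph (app_iso hom (with_proj G))"
    by (rule G.wf_digraphI_app_iso) (rule iso)
  then have "subgraph (app_iso hom (with_proj G)) (with_proj F)"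
    unfolding subgraph_def compatible_def using verts arcs F.wf_digraph
    by (auto simp: hom_def)
  then show ?thesis
    unfolding subgraph_upto_iso_def digraph_iso_def using iso by blast
qed

text \<open>
  \<open>Z\<close> plays the role of \<open>Y\<^sub>1\<close> and \<open>V - N\<close> that of \<open>X\<^sub>1\<close>, so that \<open>U\<close> is mapped onto the part
  \<open>Y\<close> and \<open>V\<close> onto the part \<open>X\<close>.
\<close>

lemma bipartite_subgraph_Z_graphI:
  fixes G :: "'a pair_pre_digraph"
  assumes G: "pair_graph G" and bip: "bipartition G U V" and card: "card U = n" "card V = n"
    and n: "n = a + b" and Z: "Z \<subseteq> U" "card Z = b" and N: "N \<subseteq> V" "card N = k"
    and nbrs: "\<And>z v. z \<in> Z \<Longrightarrow> (z, v) \<in> parcs G \<Longrightarrow> v \<in> N"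
  shows "subgraph_upto_iso G (Z_graph n k a b)"
proof -
  interpret pair_graph G by fact
  have UV: "pverts G = U \<union> V" "U \<inter> V = {}" "parcs G \<subseteq> U \<times> V \<union> V \<times> U"
    using bip by (auto simp: bipartition_def)
  have fin: "finite U" "finite V" using UV(1) pair_finite_verts by auto
  have sym: "(x, y) \<in> parcs G \<Longrightarrow> (y, x) \<in> parcs G" for x y
    using pair_sym_arcs by (auto simp: symmetric_def dest: symD)
  obtain g where g: "bij_betw g U {..<n}" "g ` Z = {..<b}"
    using exists_enumeration_initial_segment[OF fin(1) Z(1) card(1) Z(2)] .
  have cN: "card (V - N) = n - k"
    using N fin(2) card(2) by (simp add: card_Diff_subset finite_subset)
  obtain g' where g': "bij_betw g' V {..<n}" "g' ` (V - N) = {..<n - k}"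
    using exists_enumeration_initial_segment[OF fin(2) _ card(2) cN] by auto
  define f where "f x = (if x \<in> V then Inl (g' x) else Inr (g x))" for x
  have gb: "u \<in> U \<Longrightarrow> g u < n" "v \<in> V \<Longrightarrow> g' v < n" for u v
    using g(1) g'(1) by (auto simp: bij_betw_def)
  have gZ: "u \<in> Z" if "u \<in> U" "g u < b" for u
  proof -
    have "g u \<in> g ` Z" using that g(2) by auto
    then show ?thesis using that g(1) Z(1) by (auto simp: bij_betw_def dest: inj_onD)
  qed
  have gN: "v \<notin> N" if "v \<in> V" "g' v < n - k" for v
  proof -
    have "g' v \<in> g' ` (V - N)" using that g'(2) by auto
    then show ?thesis using that g'(1) by (auto simp: bij_betw_def dest: inj_onD)
  qed
  have half: "(Inl (g' v), Inr (g u)) \<in> Inl ` {..<n} \<times> Inr ` {..<a + b}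
      - Inl ` {..<n - k} \<times> Inr ` {..<b}"
    if "(u, v) \<in> parcs G" "u \<in> U" "v \<in> V" for u v
    using that gb gZ[of u] gN[of v] nbrs[of u v] n by auto
  show ?thesis
  proof (rule subgraph_upto_isoI)
    show "pair_wf_digraph G" ..
    show "pair_wf_digraph (Z_graph n k a b)"
      by unfold_locales (auto simp: Z_graph_def Let_def)
    show "inj_on f (pverts G)"
      using g(1) g'(1) UV by (auto simp: inj_on_def f_def bij_betw_def)
    show "f ` pverts G \<subseteq> pverts (Z_graph n k a b)"
      using gb UV n by (auto simp: f_def Z_graph_def Let_def)
    show "(f x, f y) \<in> parcs (Z_graph n k a b)" if xy: "(x, y) \<in> parcs G" for x y
    proof -
      consider "x \<in> U" "y \<in> V" | "x \<in> V" "y \<in> U" using xy UV by auto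
      then show ?thesis
      proof cases
        case 1
        then have "x \<notin> V" using UV by auto
        then show ?thesis using half[OF xy 1] 1 unfolding Z_graph_def Let_def f_def
          by (auto simp del: image_eqI)
      next
        case 2
        then have "y \<notin> V" using UV by auto
        then show ?thesis using half[OF sym[OF xy] 2(2,1)] 2 unfolding Z_graph_def Let_def f_def
          by (auto simp del: image_eqI)
      qed
    qed
  qed
qed

section \<open>An upper bound for the largest eigenvalue\<close>

text \<open>
  The complexified matrix \<open>C\<close> has an eigenvalue \<open>l\<close> with eigenvector \<open>v\<close>.  By symmetry the
  Hermitian form \<open>S = v\<^sup>* C v = l |v|\<^sup>2\<close> is real, so \<open>l\<close> is real and hence a root of
  the characteristic polynomial over the reals.
\<close>

lemma spectrum_real_symmetric_nonempty:
  fixes A :: "real mat"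
  assumes A: "A \<in> carrier_mat m m" and "m > 0"
    and sym: "\<And>i j. i < m \<Longrightarrow> j < m \<Longrightarrow> A $$ (i, j) = A $$ (j, i)"
  shows "spectrum A \<noteq> {}"
proof -
  define C where "C = map_mat complex_of_real A"
  have C: "C \<in> carrier_mat m m" using A by (simp add: C_def)
  obtain l where l: "eigenvalue C l"
    using spectrum_non_empty[OF C \<open>m > 0\<close>] by (auto simp: spectrum_def)
  then obtain v where v: "v \<in> carrier_vec m" "v \<noteq> 0\<^sub>v m" "C *\<^sub>v v = l \<cdot>\<^sub>v v"
    using C by (auto simp: eigenvalue_def eigenvector_def)
  have row: "(\<Sum>j<m. complex_of_real (A $$ (i, j)) * v $ j) = l * v $ i" if "i < m" for i
  proof -
    have "(C *\<^sub>v v) $ i = (\<Sum>j<m. complex_of_real (A $$ (i, j)) * v $ j)"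
      using that A v(1) C by (simp add: C_def scalar_prod_def lessThan_atLeast0)
    then show ?thesis using v that by simp
  qed
  define S where "S = (\<Sum>i<m. \<Sum>j<m. complex_of_real (A $$ (i, j)) * (cnj (v $ i) * v $ j))"
  define N where "N = (\<Sum>i<m. (cmod (v $ i))\<^sup>2)"
  have "S = (\<Sum>i<m. cnj (v $ i) * (\<Sum>j<m. complex_of_real (A $$ (i, j)) * v $ j))"
    by (simp add: S_def sum_distrib_left mult_ac)
  also have "\<dots> = (\<Sum>i<m. cnj (v $ i) * (l * v $ i))"
    using row by (intro sum.cong) auto
  also have "\<dots> = l * (\<Sum>i<m. v $ i * cnj (v $ i))"
    by (simp add: sum_distrib_left mult_ac)
  also have "\<dots> = l * complex_of_real N"
    by (simp add: N_def flip: complex_norm_square)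
  finally have S: "S = l * complex_of_real N" .
  have "cnj S = (\<Sum>i<m. \<Sum>j<m. complex_of_real (A $$ (j, i)) * (cnj (v $ j) * v $ i))"
    unfolding S_def using sym by (auto intro!: sum.cong simp: mult_ac)
  also have "\<dots> = S" unfolding S_def by (rule sum.swap)
  finally have "cnj l * complex_of_real N = l * complex_of_real N" using S by simp
  moreover have "N \<noteq> 0"
  proof
    assume "N = 0"
    then have "\<forall>i<m. v $ i = 0" by (simp add: N_def sum_nonneg_eq_0_iff)
    then show False using v(1,2) by (metis carrier_vecD eq_vecI index_zero_vec)
  qed
  ultimately have "cnj l = l" by simp
  then obtain r where r: "l = complex_of_real r"
    by (metis Reals_cases Reals_cnj_iff)
  have "complex_of_real (poly (char_poly A) r) = poly (map_poly complex_of_real (char_poly A)) l"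
    by (simp add: r of_real_hom.poly_map_poly)
  also have "\<dots> = poly (char_poly C) l"
    by (simp add: C_def of_real_hom.char_poly_hom[OF A])
  also have "\<dots> = 0" using l eigenvalue_root_char_poly[OF C] by simp
  finally have "r \<in> spectrum A" using spectrum_root_char_poly[OF A] by simp
  then show ?thesis by auto
qed

text \<open>
  Rewrites the eigenvector equation as an equation for a function on the vertices, so that
  the arbitrary vertex order behind the matrices disappears from all later arguments.
  Theta is a maximum over the real spectrum, hence an eigenvalue only because that spectrum
  is not empty.
\<close>

lemma Theta_eigenfunction:
  fixes G :: "'a pair_pre_digraph"
  assumes G: "pair_graph G" and ne: "pverts G \<noteq> {}"
  obtains x where "\<exists>a \<in> pverts G. x a \<noteq> 0"
    "\<And>a. a \<in> pverts G \<Longrightarrow>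
      Theta G \<alpha> * x a = (\<Sum>b | (a, b) \<in> parcs G. x b) + \<alpha> * real (vdegree G a) * x a"
proof -
  interpret pair_graph G by fact
  define m where "m = card (pverts G)"
  define vs where "vs = vertex_list G"
  define A where "A = adjacency_mat G + \<alpha> \<cdot>\<^sub>m degree_mat G"
  have "\<exists>vs. distinct vs \<and> set vs = pverts G"
    using finite_distinct_list[OF pair_finite_verts] by auto
  then have vs: "distinct vs" "set vs = pverts G"
    unfolding vs_def vertex_list_def by (metis (mono_tags, lifting) someI_ex)+
  then have len: "length vs = m" by (metis distinct_card m_def)
  have bij: "bij_betw ((!) vs) {..<m} (pverts G)"
    using bij_betw_nth[OF vs(1)] vs(2) len by auto
  have m: "m > 0" using ne pair_finite_verts by (simp add: m_def card_gt_0_iff)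
  have A: "A \<in> carrier_mat m m" by (simp add: A_def adjacency_mat_def degree_mat_def m_def)
  have sym: "(x, y) \<in> parcs G \<longleftrightarrow> (y, x) \<in> parcs G" for x y
    using pair_sym_arcs by (auto simp: symmetric_def dest: symD)
  have entry: "A $$ (i, j) = (if (vs ! i, vs ! j) \<in> parcs G then 1 else 0)
      + \<alpha> * (if i = j then real (vdegree G (vs ! i)) else 0)" if "i < m" "j < m" for i j
    using that by (simp add: A_def adjacency_mat_def degree_mat_def m_def vs_def mat_diag_def)
  have "spectrum A \<noteq> {}"
    using entry sym by (intro spectrum_real_symmetric_nonempty[OF A m]) auto
  then have "Theta G \<alpha> \<in> spectrum A"
    unfolding Theta_def A_def[symmetric] using card_finite_spectrum(1)[OF A] by (rule Max_in[rotated])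
  then obtain v where v: "v \<in> carrier_vec m" "v \<noteq> 0\<^sub>v m" "A *\<^sub>v v = Theta G \<alpha> \<cdot>\<^sub>v v"
    using A by (auto simp: spectrum_def eigenvalue_def eigenvector_def)
  define x where "x a = v $ (the_inv_into {..<m} ((!) vs) a)" for a
  have x: "x (vs ! i) = v $ i" if "i < m" for i
    using that bij by (simp add: x_def the_inv_into_f_f bij_betw_def)
  show ?thesis
  proof
    obtain i where "i < m" "v $ i \<noteq> 0"
      using v(1,2) by (metis carrier_vecD eq_vecI index_zero_vec)
    then show "\<exists>a\<in>pverts G. x a \<noteq> 0" using x bij by (metis bij_betwE lessThan_iff)
  next
    fix a assume "a \<in> pverts G"
    then obtain i where i: "i < m" "a = vs ! i" using bij by (auto simp: bij_betw_def)
    have "Theta G \<alpha> * x a = (A *\<^sub>v v) $ i" using v i x by simp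
    also have "\<dots> = (\<Sum>j<m. A $$ (i, j) * v $ j)"
      using i A v(1) by (simp add: scalar_prod_def lessThan_atLeast0)
    also have "\<dots> = (\<Sum>j<m. (if (a, vs ! j) \<in> parcs G then x (vs ! j) else 0)
        + (if i = j then \<alpha> * real (vdegree G a) * x a else 0))"
      using i entry x by (intro sum.cong) (auto simp: algebra_simps)
    also have "\<dots> = (\<Sum>j<m. (if (a, vs ! j) \<in> parcs G then x (vs ! j) else 0))
        + \<alpha> * real (vdegree G a) * x a"
      using i by (simp add: sum.distrib)
    also have "(\<Sum>j<m. (if (a, vs ! j) \<in> parcs G then x (vs ! j) else 0))
        = (\<Sum>b\<in>pverts G. if (a, b) \<in> parcs G then x b else 0)"
      by (rule sum.reindex_bij_betw[OF bij])
    also have "\<dots> = (\<Sum>b | (a, b) \<in> parcs G. x b)"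
      using pair_finite_verts in_arcsD2 by (intro sum.mono_neutral_cong_right) auto
    finally show "Theta G \<alpha> * x a = (\<Sum>b | (a, b) \<in> parcs G. x b) + \<alpha> * real (vdegree G a) * x a" .
  qed
qed

lemma vdegree_Image: "vdegree G a = card (parcs G `` {a})"
proof -
  have "{e \<in> parcs G. fst e = a} = {a} \<times> parcs G `` {a}" by auto
  then show ?thesis by (simp add: vdegree_eq card_cartesian_product)
qed

lemma Theta_times_square_sum:
  fixes G :: "'a pair_pre_digraph"
  assumes G: "pair_graph G" and ne: "pverts G \<noteq> {}"
  obtains x where "0 < (\<Sum>a\<in>pverts G. (x a)\<^sup>2)"
    "Theta G \<alpha> * (\<Sum>a\<in>pverts G. (x a)\<^sup>2)
      = (\<Sum>(a, b)\<in>parcs G. x a * x b) + \<alpha> * (\<Sum>a\<in>pverts G. real (vdegree G a) * (x a)\<^sup>2)"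
proof -
  interpret pair_graph G by fact
  obtain x where x: "\<exists>a \<in> pverts G. x a \<noteq> 0"
    "\<And>a. a \<in> pverts G \<Longrightarrow>
      Theta G \<alpha> * x a = (\<Sum>b | (a, b) \<in> parcs G. x b) + \<alpha> * real (vdegree G a) * x a"
    using Theta_eigenfunction[OF assms] by blast
  show ?thesis
  proof
    show "0 < (\<Sum>a\<in>pverts G. (x a)\<^sup>2)"
      using x(1) pair_finite_verts by (auto intro: sum_pos2)
    have "Theta G \<alpha> * (\<Sum>a\<in>pverts G. (x a)\<^sup>2) = (\<Sum>a\<in>pverts G. x a * (Theta G \<alpha> * x a))"
      by (simp add: sum_distrib_left power2_eq_square mult_ac)
    also have "\<dots> = (\<Sum>a\<in>pverts G. (\<Sum>b\<in>parcs G `` {a}. x a * x b)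
        + \<alpha> * (real (vdegree G a) * (x a)\<^sup>2))"
      using x(2) by (intro sum.cong refl)
        (simp add: distrib_left sum_distrib_left power2_eq_square mult_ac Image_singleton)
    also have "\<dots> = (\<Sum>a\<in>pverts G. \<Sum>b\<in>parcs G `` {a}. x a * x b)
        + \<alpha> * (\<Sum>a\<in>pverts G. real (vdegree G a) * (x a)\<^sup>2)"
      by (simp add: sum.distrib sum_distrib_left)
    also have "(\<Sum>a\<in>pverts G. \<Sum>b\<in>parcs G `` {a}. x a * x b)
        = (\<Sum>(a, b)\<in>(SIGMA a:pverts G. parcs G `` {a}). x a * x b)"
      using pair_finite_verts pair_finite_arcs by (intro sum.Sigma) (auto intro: finite_Image)
    also have "(SIGMA a:pverts G. parcs G `` {a}) = parcs G" by (auto dest: in_arcsD1)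
    finally show "Theta G \<alpha> * (\<Sum>a\<in>pverts G. (x a)\<^sup>2)
      = (\<Sum>(a, b)\<in>parcs G. x a * x b) + \<alpha> * (\<Sum>a\<in>pverts G. real (vdegree G a) * (x a)\<^sup>2)" .
  qed
qed

lemma card_arcs_between_swap:
  assumes "pair_graph G"
  shows "card (parcs G \<inter> V \<times> U) = card (parcs G \<inter> U \<times> V)"
proof -
  interpret pair_graph G by fact
  have "parcs G \<inter> V \<times> U = prod.swap ` (parcs G \<inter> U \<times> V)"
    using pair_sym_arcs by (auto simp: symmetric_def dest: symD)
  then show ?thesis by (simp add: card_image)
qed

lemma sum_arcs_bipartite:
  fixes g :: "'a \<times> 'a \<Rightarrow> real"
  assumes G: "pair_graph G" and bip: "bipartition G U V"
  shows "sum g (parcs G) = (\<Sum>(u, v)\<in>parcs G \<inter> U \<times> V. g (u, v) + g (v, u))"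
proof -
  interpret pair_graph G by fact
  define E where "E = parcs G \<inter> U \<times> V"
  have sym: "(x, y) \<in> parcs G \<longleftrightarrow> (y, x) \<in> parcs G" for x y
    using pair_sym_arcs by (auto simp: symmetric_def dest: symD)
  have *: "parcs G = E \<union> prod.swap ` E" "E \<inter> prod.swap ` E = {}"
    using bip sym by (auto simp: E_def bipartition_def)
  have "finite E" using pair_finite_arcs by (simp add: E_def)
  then have "sum g (parcs G) = sum g E + sum g (prod.swap ` E)"
    by (subst *(1)) (use *(2) in \<open>simp add: sum.union_disjoint\<close>)
  also have "sum g (prod.swap ` E) = (\<Sum>e\<in>E. g (prod.swap e))"
    by (subst sum.reindex) (auto simp: inj_on_def)
  finally show ?thesis
    by (simp add: E_def sum.distrib case_prod_unfold prod.swap_def)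
qed

text \<open>
  The Cauchy--Schwarz inequality over the \<open>e\<close> edges bounds the form by
  \<open>2 sqrt e sqrt (P Q)\<close>, where \<open>P\<close> and \<open>Q\<close> are the square sums of \<open>x\<close> over \<open>U\<close> and \<open>V\<close>, and
  \<open>4 P Q \<le> (P + Q)\<^sup>2\<close>.
\<close>

lemma adjacency_form_le:
  fixes x :: "'a \<Rightarrow> real"
  assumes G: "pair_graph G" and bip: "bipartition G U V"
  shows "(\<Sum>(a, b)\<in>parcs G. x a * x b)
      \<le> sqrt (real (card (parcs G \<inter> U \<times> V))) * (\<Sum>a\<in>pverts G. (x a)\<^sup>2)"
proof -
  interpret pair_graph G by fact
  define E where "E = parcs G \<inter> U \<times> V"
  define P where "P = (\<Sum>u\<in>U. (x u)\<^sup>2)"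
  define Q where "Q = (\<Sum>v\<in>V. (x v)\<^sup>2)"
  have UV: "pverts G = U \<union> V" "U \<inter> V = {}" using bip by (auto simp: bipartition_def)
  have fin: "finite U" "finite V" using UV pair_finite_verts by auto
  have PQ: "0 \<le> P" "0 \<le> Q" by (simp_all add: P_def Q_def sum_nonneg)
  define S where "S = (\<Sum>(u, v)\<in>E. x u * x v)"
  have "S\<^sup>2 \<le> (\<Sum>(u, v)\<in>E. (x u * x v)\<^sup>2) * real (card E)"
    using sum_squared_le_sum_of_squares[of "\<lambda>(u, v). x u * x v" E]
    by (simp add: S_def case_prod_unfold)
  also have "(\<Sum>(u, v)\<in>E. (x u * x v)\<^sup>2) \<le> (\<Sum>(u, v)\<in>U \<times> V. (x u * x v)\<^sup>2)"
    using fin by (intro sum_mono2) (auto simp: E_def)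
  also have "\<dots> = P * Q"
    by (simp add: P_def Q_def sum_product sum.cartesian_product power_mult_distrib)
  finally have S2: "S\<^sup>2 \<le> P * Q * real (card E)" by (simp add: mult_right_mono)
  have "(2 * S)\<^sup>2 \<le> (P + Q)\<^sup>2 * real (card E)"
  proof -
    have "4 * (P * Q) \<le> (P + Q)\<^sup>2"
      using zero_le_power2[of "P - Q"] by (simp add: power2_eq_square algebra_simps)
    then have "4 * (P * Q) * real (card E) \<le> (P + Q)\<^sup>2 * real (card E)" by (rule mult_right_mono) simp
    then show ?thesis using S2 by (simp add: power_mult_distrib)
  qed
  then have "2 * S \<le> sqrt ((P + Q)\<^sup>2 * real (card E))" by (rule real_le_rsqrt)
  also have "\<dots> = sqrt (real (card E)) * (P + Q)"
    using PQ by (simp add: real_sqrt_mult)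
  also have "P + Q = (\<Sum>a\<in>pverts G. (x a)\<^sup>2)"
    using fin UV by (simp add: P_def Q_def sum.union_disjoint)
  also have "2 * S = (\<Sum>(a, b)\<in>parcs G. x a * x b)"
    unfolding sum_arcs_bipartite[OF G bip]
    by (simp add: S_def E_def sum_distrib_left case_prod_unfold mult.commute)
  finally show ?thesis by (simp add: E_def)
qed

text \<open>
  To be read with \<open>d\<close> the degree of a vertex and \<open>S\<close> the sum of the degrees of its
  neighbours.  If \<open>d \<le> e / n\<close>, the average \<open>S / d\<close> is bounded by \<open>n\<close>.  On the remaining
  interval from \<open>e / n\<close> to \<open>n\<close> the convex function \<open>d + e / d\<close> takes the value \<open>e / n + n\<close> at
  both ends.
\<close>

lemma degree_plus_average_le:
  fixes d S e n :: real
  assumes "0 < d" "d \<le> n" "S \<le> e" "S \<le> n * d"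
  shows "d + S / d \<le> e / n + n"
proof (cases "d \<le> e / n")
  case True
  have "S / d \<le> n" using assms by (simp add: divide_le_eq)
  then show ?thesis using True by simp
next
  case False
  have n: "n > 0" using assms by simp
  then have "e \<le> n * d" using False by (simp add: field_simps)
  then have "0 \<le> (n - d) * (n * d - e)" using assms by simp
  then have "d * d * n + e * n \<le> e * d + n * n * d" by (simp add: algebra_simps)
  then have "d + e / d \<le> e / n + n" using n \<open>0 < d\<close> by (simp add: field_simps)
  moreover have "S / d \<le> e / d" using assms by (simp add: divide_right_mono)
  ultimately show ?thesis by simp
qed

text \<open>
  For every edge \<open>ab\<close> one has \<open>2 x\<^sub>a x\<^sub>b \<le> (d\<^sub>b / d\<^sub>a) x\<^sub>a\<^sup>2 + (d\<^sub>a / d\<^sub>b) x\<^sub>b\<^sup>2\<close>.  Summed over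
  all edges, the coefficient of \<open>x\<^sub>a\<^sup>2\<close> becomes the average degree of the neighbours of \<open>a\<close>;
  this is the classical bound for the signless Laplacian by the maximum of degree plus
  average neighbour degree.
\<close>

lemma signless_laplacian_form_le:
  fixes x :: "'a \<Rightarrow> real" and n :: nat
  assumes G: "pair_graph G" and bip: "bipartition G U V" and card: "card U = n" "card V = n"
    and pos: "\<And>a. a \<in> pverts G \<Longrightarrow> 0 < vdegree G a"
  shows "(\<Sum>(a, b)\<in>parcs G. x a * x b) + (\<Sum>a\<in>pverts G. real (vdegree G a) * (x a)\<^sup>2)
      \<le> (real (card (parcs G \<inter> U \<times> V)) / real n + real n) * (\<Sum>a\<in>pverts G. (x a)\<^sup>2)"
proof -
  interpret pair_graph G by fact
  define E where "E = parcs G \<inter> U \<times> V"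
  define d where "d a = real (vdegree G a)" for a
  have UV: "pverts G = U \<union> V" "U \<inter> V = {}" "parcs G \<subseteq> U \<times> V \<union> V \<times> U"
    using bip by (auto simp: bipartition_def)
  have fin: "finite U" "finite V" using UV(1) pair_finite_verts by auto
  have sym: "(x, y) \<in> parcs G \<longleftrightarrow> (y, x) \<in> parcs G" for x y
    using pair_sym_arcs by (auto simp: symmetric_def dest: symD)
  have dpos: "0 < d a" if "a \<in> pverts G" for a using pos[OF that] by (simp add: d_def)
  have nb: "parcs G `` {a} \<subseteq> V" if "a \<in> U" for a using that UV by auto
  have nb': "parcs G `` {a} \<subseteq> U" if "a \<in> V" for a using that UV by auto
  have dn: "d a \<le> real n" if "a \<in> pverts G" for a
  proof -
    have "card (parcs G `` {a}) \<le> n"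
      using that UV(1) card card_mono[OF fin(2) nb] card_mono[OF fin(1) nb'] by auto
    then show ?thesis by (simp add: d_def vdegree_Image)
  qed
  have out: "(\<Sum>b\<in>W. d b) = real (card (parcs G \<inter> W \<times> UNIV))" if "finite W" for W
  proof -
    have "parcs G \<inter> W \<times> UNIV = (SIGMA b:W. parcs G `` {b})" by auto
    then show ?thesis
      using that pair_finite_arcs by (simp add: d_def vdegree_Image finite_Image)
  qed
  have eV: "card (parcs G \<inter> V \<times> U) = card E"
    unfolding E_def by (rule card_arcs_between_swap[OF G])
  have edges: "(\<Sum>b\<in>U. d b) = real (card E)" "(\<Sum>b\<in>V. d b) = real (card E)"
  proof -
    have "parcs G \<inter> U \<times> UNIV = E" "parcs G \<inter> V \<times> UNIV = parcs G \<inter> V \<times> U"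
      using UV by (auto simp: E_def)
    then show "(\<Sum>b\<in>U. d b) = real (card E)" "(\<Sum>b\<in>V. d b) = real (card E)"
      using out[OF fin(1)] out[OF fin(2)] eV by simp_all
  qed
  have nbr_sum: "(\<Sum>b\<in>parcs G `` {a}. d b) \<le> real (card E)" if "a \<in> pverts G" for a
  proof -
    have "(\<Sum>b\<in>parcs G `` {a}. d b) \<le> (\<Sum>b\<in>V. d b)" if "a \<in> U"
      by (rule sum_mono2[OF fin(2) nb[OF that]]) (simp add: d_def)
    moreover have "(\<Sum>b\<in>parcs G `` {a}. d b) \<le> (\<Sum>b\<in>U. d b)" if "a \<in> V"
      by (rule sum_mono2[OF fin(1) nb'[OF that]]) (simp add: d_def)
    ultimately show ?thesis using that UV(1) edges by auto
  qed
  have nbr_sum': "(\<Sum>b\<in>parcs G `` {a}. d b) \<le> real n * d a" for a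
  proof -
    have "(\<Sum>b\<in>parcs G `` {a}. d b) \<le> (\<Sum>b\<in>parcs G `` {a}. real n)"
      by (intro sum_mono dn) (auto dest: in_arcsD2)
    then show ?thesis by (simp add: d_def vdegree_Image mult.commute)
  qed
  define w where "w a b = d b / d a * (x a)\<^sup>2" for a b
  have "(\<Sum>(a, b)\<in>parcs G. x a * x b) \<le> (\<Sum>(a, b)\<in>parcs G. (w a b + w b a) / 2)"
  proof (intro sum_mono, clarify)
    fix a b assume "(a, b) \<in> parcs G"
    then have p: "0 < d a" "0 < d b" using dpos in_arcsD1 in_arcsD2 by auto
    have "0 \<le> (d b * x a - d a * x b)\<^sup>2 / (d a * d b)" using p by simp
    also have "\<dots> = w a b + w b a - 2 * (x a * x b)"
      using p by (simp add: w_def power2_eq_square field_simps)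
    finally show "x a * x b \<le> (w a b + w b a) / 2" by simp
  qed
  also have "\<dots> = (\<Sum>(a, b)\<in>parcs G. w a b)"
  proof -
    have "(\<Sum>(a, b)\<in>parcs G. w b a) = (\<Sum>(a, b)\<in>parcs G. w a b)"
      by (rule sum.reindex_bij_witness[of _ prod.swap prod.swap]) (use sym in auto)
    then show ?thesis
      by (simp add: case_prod_unfold sum.distrib add_divide_distrib flip: sum_divide_distrib)
  qed
  also have "\<dots> = (\<Sum>a\<in>pverts G. \<Sum>b\<in>parcs G `` {a}. w a b)"
  proof -
    have "(SIGMA a:pverts G. parcs G `` {a}) = parcs G" by (auto dest: in_arcsD1)
    then show ?thesis
      using sum.Sigma[of "pverts G" "\<lambda>a. parcs G `` {a}" w] pair_finite_verts pair_finite_arcs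
      by (simp add: finite_Image)
  qed
  also have "\<dots> = (\<Sum>a\<in>pverts G. (\<Sum>b\<in>parcs G `` {a}. d b) / d a * (x a)\<^sup>2)"
    by (simp add: w_def sum_distrib_right sum_divide_distrib)
  finally have "(\<Sum>(a, b)\<in>parcs G. x a * x b) + (\<Sum>a\<in>pverts G. d a * (x a)\<^sup>2)
      \<le> (\<Sum>a\<in>pverts G. (d a + (\<Sum>b\<in>parcs G `` {a}. d b) / d a) * (x a)\<^sup>2)"
    by (simp add: sum.distrib distrib_right)
  also have "\<dots> \<le> (\<Sum>a\<in>pverts G. (real (card E) / real n + real n) * (x a)\<^sup>2)"
    using dpos dn nbr_sum nbr_sum'
    by (intro sum_mono mult_right_mono degree_plus_average_le) auto
  finally show ?thesis by (simp add: sum_distrib_left d_def E_def)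
qed

text \<open>
  The matrix is the convex combination of \<open>A + D\<close> and \<open>A\<close> with weights \<open>\<alpha>\<close> and
  \<open>1 - \<alpha>\<close>, so the bounds for the two quadratic forms can be combined.  With \<^term>\<open>eps0 n k s\<close>
  in place of \<open>e\<close> the right-hand side is \<^term>\<open>Theta0 \<alpha> n k s\<close>.
\<close>

lemma Theta_le:
  fixes \<alpha> :: real
  assumes G: "pair_graph G" and bip: "bipartition G U V" and card: "card U = n" "card V = n"
    and "0 < n" and pos: "\<And>a. a \<in> pverts G \<Longrightarrow> 0 < vdegree G a" and \<alpha>: "0 \<le> \<alpha>" "\<alpha> \<le> 1"
  defines "e \<equiv> real (card (parcs G \<inter> U \<times> V))"
  shows "Theta G \<alpha> \<le> \<alpha> * (e / real n + real n) + (1 - \<alpha>) * sqrt e"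
proof -
  have ne: "pverts G \<noteq> {}" using bip card \<open>0 < n\<close> by (auto simp: bipartition_def)
  obtain x where pos': "0 < (\<Sum>a\<in>pverts G. (x a)\<^sup>2)" and
    eq: "Theta G \<alpha> * (\<Sum>a\<in>pverts G. (x a)\<^sup>2)
      = (\<Sum>(a, b)\<in>parcs G. x a * x b) + \<alpha> * (\<Sum>a\<in>pverts G. real (vdegree G a) * (x a)\<^sup>2)"
    using Theta_times_square_sum[OF G ne] by blast
  define q where "q = (\<Sum>(a, b)\<in>parcs G. x a * x b)"
  define D where "D = (\<Sum>a\<in>pverts G. real (vdegree G a) * (x a)\<^sup>2)"
  define X where "X = (\<Sum>a\<in>pverts G. (x a)\<^sup>2)"
  have "Theta G \<alpha> * X = \<alpha> * (q + D) + (1 - \<alpha>) * q"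
    using eq by (simp add: q_def D_def X_def algebra_simps)
  also have "\<dots> \<le> \<alpha> * ((e / real n + real n) * X) + (1 - \<alpha>) * (sqrt e * X)"
    using signless_laplacian_form_le[OF G bip card pos] adjacency_form_le[OF G bip] \<alpha>
    unfolding q_def D_def X_def e_def by (intro add_mono mult_left_mono) auto
  also have "\<dots> = (\<alpha> * (e / real n + real n) + (1 - \<alpha>) * sqrt e) * X"
    by (simp add: algebra_simps)
  finally show ?thesis using pos' by (simp add: X_def)
qed

section \<open>The closure of a dense graph\<close>

text \<open>
  Transfers the extremal result to a closed graph \<open>H\<close> above \<open>G\<close>.  Only the case
  \<^term>\<open>vdegree H u \<le> vdegree H v\<close> is treated; the other one follows by exchanging \<open>U\<close>
  and \<open>V\<close>, which is possible because \<^const>\<open>F_graph\<close> does not refer to the parts of \<open>G\<close>.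
\<close>

lemma closed_pair_graph_subgraph_F_graph:
  fixes G H :: "'a pair_pre_digraph" and n :: nat and k s :: int
  assumes G: "pair_graph G" "bipartition G U V" and GH: "parcs G \<subseteq> parcs H"
    and H: "pair_graph H" "bipartition H U V"
    and card: "card U = n" "card V = n"
    and ks: "0 \<le> k" "s \<le> k" "2 * k + 2 \<le> int n + s"
    and deg: "\<And>a. a \<in> pverts H \<Longrightarrow> k \<le> int (vdegree H a)"
    and closed: "\<And>u v. u \<in> U \<Longrightarrow> v \<in> V \<Longrightarrow> (u, v) \<notin> parcs H \<Longrightarrow>
        int (vdegree H u + vdegree H v) < int n + s"
    and dense: "eps0 n k s < int (card (parcs H \<inter> U \<times> V))"
    and uv: "u \<in> U" "v \<in> V" "(u, v) \<notin> parcs H"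
    and max: "\<And>u' v'. u' \<in> U \<Longrightarrow> v' \<in> V \<Longrightarrow> (u', v') \<notin> parcs H \<Longrightarrow>
        vdegree H u' + vdegree H v' \<le> vdegree H u + vdegree H v"
    and le: "vdegree H u \<le> vdegree H v"
  shows "subgraph_upto_iso G (F_graph n k s)"
proof -
  interpret H: pair_graph H by fact
  define E where "E = parcs H \<inter> U \<times> V"
  have UV: "pverts H = U \<union> V" "U \<inter> V = {}" "parcs H \<subseteq> U \<times> V \<union> V \<times> U"
    using H(2) by (auto simp: bipartition_def)
  have fin: "finite U" "finite V" using UV(1) H.pair_finite_verts by auto
  have sym: "(x, y) \<in> parcs H \<Longrightarrow> (y, x) \<in> parcs H" for x y
    using H.pair_sym_arcs by (auto simp: symmetric_def dest: symD)
  have dU: "card (E `` {x}) = vdegree H x" if "x \<in> U" for x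
  proof -
    have "E `` {x} = parcs H `` {x}" using that UV by (auto simp: E_def)
    then show ?thesis by (simp add: vdegree_Image)
  qed
  have dV: "card (E\<inverse> `` {y}) = vdegree H y" if "y \<in> V" for y
  proof -
    have "E\<inverse> `` {y} = parcs H `` {y}" using that UV by (auto simp: E_def intro: sym)
    then show ?thesis by (simp add: vdegree_Image)
  qed
  have "\<exists>Z N. Z \<subseteq> U \<and> N \<subseteq> V \<and> int (card Z) = k + 1 - s \<and> int (card N) = k \<and> E `` Z \<subseteq> N"
  proof (rule closed_bipartite_low_degree_set[OF fin card])
    show "E \<subseteq> U \<times> V" by (simp add: E_def)
    have "int (card (U \<times> V - E)) = int n * int n - int (card E)"
      using card fin card_mono[of "U \<times> V" E]
      by (simp add: E_def card_Diff_subset card_cartesian_product of_nat_diff)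
    then show "int (card (U \<times> V - E)) < (int n - k - 1) * (k + 2 - s)"
      using dense by (simp add: E_def eps0_def algebra_simps)
    show "s \<le> k" by fact
    show "(u, v) \<in> U \<times> V - E" using uv by (simp add: E_def)
    show "card (E `` {u}) \<le> card (E\<inverse> `` {v})" using le uv dU dV by simp
    show "k \<le> int (card (E `` {x}))" if "x \<in> U" for x using dU[OF that] deg that UV by simp
    show "k \<le> int (card (E\<inverse> `` {y}))" if "y \<in> V" for y using dV[OF that] deg that UV by simp
    show "int (card (E `` {x}) + card (E\<inverse> `` {y})) < int n + s" if "(x, y) \<in> U \<times> V - E" for x y
      using closed[of x y] that dU[of x] dV[of y] by (auto simp: E_def)
    show "card (E `` {x}) + card (E\<inverse> `` {y}) \<le> card (E `` {u}) + card (E\<inverse> `` {v})"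
      if "(x, y) \<in> U \<times> V - E" for x y
      using max[of x y] that dU[of x] dV[of y] dU[OF uv(1)] dV[OF uv(2)] by (auto simp: E_def)
  qed
  then obtain Z N where ZN: "Z \<subseteq> U" "N \<subseteq> V" "int (card Z) = k + 1 - s" "int (card N) = k" "E `` Z \<subseteq> N"
    by blast
  show ?thesis unfolding F_graph_def
  proof (rule bipartite_subgraph_Z_graphI[OF G card _ ZN(1) _ ZN(2)])
    show "n = nat (int n + s - k - 1) + nat (k + 1 - s)" using ks by linarith
    show "card Z = nat (k + 1 - s)" "card N = nat k" using ZN by linarith+
    show "v \<in> N" if "z \<in> Z" "(z, v) \<in> parcs G" for z v
    proof -
      have "(z, v) \<in> parcs H" "z \<in> U" using that ZN(1) GH by auto
      then have "(z, v) \<in> E" using UV(2,3) unfolding E_def by blast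
      then show ?thesis using that ZN(5) by blast
    qed
  qed
qed

lemma closure_steps_bipartition:
  assumes "(closure_step l U V)\<^sup>*\<^sup>* G H" "bipartition G U V"
  shows "bipartition H U V"
  using assms
  by (induction rule: rtranclp_induct)
     (auto simp: closure_step_def join_verts_def joinable_def bipartition_def)

lemma pair_graph_bipartitionI:
  assumes "bipartition H U V" "finite (pverts H)" "finite (parcs H)" "sym (parcs H)"
  shows "pair_graph H"
  using assms by unfold_locales (auto simp: bipartition_def symmetric_def)

lemma bipartition_swap: "bipartition G U V \<Longrightarrow> bipartition G V U"
  by (auto simp: bipartition_def)

lemma closure_complete_or_subgraph_F_graph:
  fixes G :: "'a pair_pre_digraph" and n :: nat and k s :: int
  assumes G: "pair_graph G" "bipartition G U V" and card: "card U = n" "card V = n"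
    and ks: "0 \<le> k" "s \<le> k" "2 * k + 2 \<le> int n + s"
    and deg: "\<And>a. a \<in> pverts G \<Longrightarrow> k \<le> int (vdegree G a)"
    and dense: "eps0 n k s < int (card (parcs G \<inter> U \<times> V))"
  shows "complete_bipartite_digraph n n (with_proj (bipartite_closure (int n + s) U V G))
       \<or> subgraph_upto_iso G (F_graph n k s)"
proof -
  interpret pair_graph G by fact
  define H where "H = bipartite_closure (int n + s) U V G"
  have "is_bip_closure (int n + s) U V G H"
    unfolding H_def by (rule bipartite_closure[OF G])
  then have steps: "(closure_step (int n + s) U V)\<^sup>*\<^sup>* G H"
    and stop: "\<nexists>u v. joinable (int n + s) U V H u v"
    by (auto simp: is_bip_closure_def)
  have "sym (parcs G)" using pair_sym_arcs by (simp add: symmetric_def)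
  then have props: "pverts H = pverts G" "parcs G \<subseteq> parcs H" "finite (parcs H)" "sym (parcs H)"
    using closure_steps_properties[OF steps pair_finite_arcs] by auto
  have bipH: "bipartition H U V" by (rule closure_steps_bipartition[OF steps G(2)])
  have H: "pair_graph H"
    using props pair_finite_verts by (intro pair_graph_bipartitionI[OF bipH]) auto
  have UV: "pverts H = U \<union> V" "U \<inter> V = {}" "parcs H \<subseteq> U \<times> V \<union> V \<times> U"
    using bipH by (auto simp: bipartition_def)
  have fin: "finite U" "finite V" using UV(1) props(1) pair_finite_verts by auto
  have sym: "(x, y) \<in> parcs H \<longleftrightarrow> (y, x) \<in> parcs H" for x y
    using props(4) by (auto dest: symD)
  have degH: "k \<le> int (vdegree H a)" if "a \<in> pverts H" for a
    using deg[of a] vdegree_mono[OF props(3,2), of a] that props(1) by simp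
  have closed: "int (vdegree H u + vdegree H v) < int n + s"
    if "u \<in> U" "v \<in> V" "(u, v) \<notin> parcs H" for u v
    using stop that by (force simp: joinable_def)
  have "card (parcs G \<inter> U \<times> V) \<le> card (parcs H \<inter> U \<times> V)"
    using props(2,3) by (intro card_mono) auto
  then have denseH: "eps0 n k s < int (card (parcs H \<inter> U \<times> V))" using dense by simp
  have denseH': "eps0 n k s < int (card (parcs H \<inter> V \<times> U))"
    using denseH card_arcs_between_swap[OF H, of V U] by simp
  show ?thesis
  proof (cases "U \<times> V \<subseteq> parcs H")
    case True
    then have "parcs H = U \<times> V \<union> V \<times> U" using UV(3) sym by auto
    then have "complete_bipartite_digraph n n (with_proj H)"
      unfolding complete_bipartite_digraph_pair_def using UV fin card by auto
    then show ?thesis by (simp add: H_def)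
  next
    case False
    define M where "M = U \<times> V - parcs H"
    define f where "f = (\<lambda>(u, v). vdegree H u + vdegree H v)"
    have M: "finite M" "M \<noteq> {}" using fin False by (auto simp: M_def)
    then have "Max (f ` M) \<in> f ` M" by (intro Max_in) auto
    then obtain u v where uv: "(u, v) \<in> M" "f (u, v) = Max (f ` M)" by auto
    have uvM: "u \<in> U" "v \<in> V" "(u, v) \<notin> parcs H" using uv(1) by (auto simp: M_def)
    have max: "vdegree H u' + vdegree H v' \<le> vdegree H u + vdegree H v"
      if "u' \<in> U" "v' \<in> V" "(u', v') \<notin> parcs H" for u' v'
    proof -
      have "f (u', v') \<le> Max (f ` M)" using that M by (intro Max_ge) (auto simp: M_def)
      then show ?thesis using uv(2) by (simp add: f_def)
    qed
    have "subgraph_upto_iso G (F_graph n k s)"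
    proof (cases "vdegree H u \<le> vdegree H v")
      case True
      show ?thesis
        by (rule closed_pair_graph_subgraph_F_graph[OF G props(2) H bipH card ks degH closed denseH
              uvM max True])
    next
      case False
      show ?thesis
      proof (rule closed_pair_graph_subgraph_F_graph[OF G(1) bipartition_swap[OF G(2)] props(2) H
              bipartition_swap[OF bipH] card(2,1) ks degH _ denseH' uvM(2,1)])
        show "(v, u) \<notin> parcs H" using uvM sym by simp
        show "vdegree H v \<le> vdegree H u" using False by simp
        show "int (vdegree H v' + vdegree H u') < int n + s"
          if "v' \<in> V" "u' \<in> U" "(v', u') \<notin> parcs H" for v' u'
          using closed[of u' v'] that sym[of v' u'] by simp
        show "vdegree H v' + vdegree H u' \<le> vdegree H v + vdegree H u"
          if "v' \<in> V" "u' \<in> U" "(v', u') \<notin> parcs H" for v' u'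
          using max[of u' v'] that sym[of v' u'] by simp
      qed
    qed
    then show ?thesis ..
  qed
qed

theorem theorem1p18:
  fixes k s :: int and \<alpha> :: real and n :: nat
    and G :: "'a pair_pre_digraph" and U V :: "'a set"
  assumes "s \<ge> -2"
    and "pair_graph G"
    and "bipartition G U V"
    and "card U = card V"
    and "card (pverts G) = 2 * n"
    and "2 * int n \<ge> 6 * k + 8"
    and "int (min_degree G) \<ge> k"
    and "k \<ge> max \<bar>s\<bar> 1"
    and "Theta G \<alpha> > Theta0 \<alpha> n k s"
    and "0 \<le> \<alpha>" and "\<alpha> \<le> 1"
  shows "complete_bipartite_digraph n n (with_proj (bipartite_closure (int n + s) U V G))
       \<or> subgraph_upto_iso G (F_graph n k s)"
proof -
  interpret pair_graph G by fact
  have UV: "pverts G = U \<union> V" "U \<inter> V = {}"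
    using assms(3) by (auto simp: bipartition_def)
  then have "card U + card V = 2 * n"
    using assms(5) pair_finite_verts by (simp add: card_Un_disjoint)
  then have card: "card U = n" "card V = n" using assms(4) by auto
  have ks: "1 \<le> k" "s \<le> k" "2 * k + 2 \<le> int n + s" "0 < n"
    using assms(6,8) by linarith+
  have deg: "k \<le> int (vdegree G a)" if "a \<in> pverts G" for a
  proof -
    have "min_degree G \<le> vdegree G a"
      unfolding min_degree_def using that pair_finite_verts by (intro Min_le) auto
    then show ?thesis using assms(7) by linarith
  qed
  have pos: "0 < vdegree G a" if "a \<in> pverts G" for a using deg[OF that] ks(1) by linarith
  define e where "e = card (parcs G \<inter> U \<times> V)"
  have "eps0 n k s < int e"
  proof (rule ccontr)
    assume "\<not> ?thesis"
    then have le: "real e \<le> real_of_int (eps0 n k s)" by linarith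
    have "Theta G \<alpha> \<le> \<alpha> * (real e / real n + real n) + (1 - \<alpha>) * sqrt (real e)"
      unfolding e_def by (rule Theta_le[OF assms(2,3) card ks(4) pos assms(10,11)])
    also have "\<dots> \<le> Theta0 \<alpha> n k s"
      unfolding Theta0_def using le assms(10,11)
      by (intro add_mono mult_left_mono divide_right_mono real_sqrt_le_mono order_refl) auto
    finally show False using assms(9) by simp
  qed
  then show ?thesis
    unfolding e_def using ks by (intro closure_complete_or_subgraph_F_graph[OF assms(2,3) card _ _ _ deg]) auto
qed

end
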